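(* Let $(G,b,m)$, $G=(V_G,\vec E_G)$, be a finite connected weighted directed graph satisfying the standing assumptions in the context, with $\#V_G=n$, and let $H=(V_H,\vec E_H)$ be a connected subgraph of $G$ with $\#V_H=r$. Then for every $1\le k\le r$, $$\lambda_k(S_H)\le\lambda_{n-r+k}(S_G).$$
   Context: Setting. $G=(V,\vec E)$ is a directed graph with $V$ a finite nonempty set and $\vec E\subset V\times V$; $b:V\times V\to[0,\infty)$ satisfies $b(x,x)=0$ for all $x$ and $b(x,y)>0$ iff $(x,y)\in\vec E$; $m:V\to(0,\infty)$. Put $V_x^+=\{y:(x,y)\in\vec E\}$, $V_x^-=\{y:(y,x)\in\vec E\}$, $V_x=V_x^+\cup V_x^-$. A graph is connected if any two distinct vertices are joined by a directed path from one of them to the other. Standing assumptions on $G$: (i) connected; (ii) $V_x^+\ne\emptyset$ and $V_x^-\neq\emptyset$ for all $x$; (iii) Assumption $(\beta)$: $\sum_{y\in V_x^+}b(x,y)=\sum_{y\in V_x^-}b(y,x)$ for all $x\in V$. Functions $f:V\to\mathbb C$ carry the inner product $(f,g)_m=\sum_{x}m(x)f(x)\overline{g(x)}$. With $a(x,y)=b(x,y)+b(y,x)$, the special Laplacian is the self-adjoint operator $S_Gf(x)=\frac1{m(x)}\sum_{y\in V_x}a(x,y)(f(x)-f(y))$. A subgraph $H=(V_H,\vec E_H)$ of $G$ is an induced one: $V_H\subset V_G$ and $\vec E_H=(V_H\times V_H)\cap\vec E_G$. It carries the restricted weights $b,m$, and $S_H$ acts on functions on $V_H$ by $S_Hf(x)=\frac1{m(x)}\sum_{y\in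 V_x\cap V_H}a(x,y)(f(x)-f(y))$. Eigenvalues are listed in nondecreasing order with multiplicity: $\lambda_1\le\lambda_2\le\cdots$. *)

theory Defs
  imports Complex_Main "HOL-Library.Function_Algebras"
begin

(* A directed graph is a vertex set V together with an edge relation E. The weights b and m are
   total functions on the vertex type; only their values on V matter. *)

locale weighted_digraph =
  fixes V :: "'a set" and E :: "('a \<times> 'a) set" and b :: "'a \<Rightarrow> 'a \<Rightarrow> real" and m :: "'a \<Rightarrow> real"
  assumes finite_vertices: "finite V"
    and vertices_nonempty: "V \<noteq> {}"
    and edges_subset: "E \<subseteq> V \<times> V"
    and b_nonneg: "\<And>x y. x \<in> V \<Longrightarrow> y \<in> V \<Longrightarrow> b x y \<ge> 0"
    and b_diag: "\<And>x. x \<in> V \<Longrightarrow> b x x = 0"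
    and b_pos_iff: "\<And>x y. x \<in> V \<Longrightarrow> y \<in> V \<Longrightarrow> b x y > 0 \<longleftrightarrow> (x, y) \<in> E"
    and m_pos: "\<And>x. x \<in> V \<Longrightarrow> m x > 0"

definition out_nbrs :: "('a \<times> 'a) set \<Rightarrow> 'a \<Rightarrow> 'a set" where
  "out_nbrs E x = {y. (x, y) \<in> E}"

definition in_nbrs :: "('a \<times> 'a) set \<Rightarrow> 'a \<Rightarrow> 'a set" where
  "in_nbrs E x = {y. (y, x) \<in> E}"

definition nbrs :: "('a \<times> 'a) set \<Rightarrow> 'a \<Rightarrow> 'a set" where
  "nbrs E x = out_nbrs E x \<union> in_nbrs E x"

(* A directed path in one of the two directions suffices: this is weaker than strong
   connectedness and stronger than connectedness of the underlying undirected graph. *)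
definition connected_digraph :: "'a set \<Rightarrow> ('a \<times> 'a) set \<Rightarrow> bool" where
  "connected_digraph V E \<longleftrightarrow>
     (\<forall>x\<in>V. \<forall>y\<in>V. x \<noteq> y \<longrightarrow> (x, y) \<in> E\<^sup>* \<or> (y, x) \<in> E\<^sup>*)"

definition assumption_beta :: "'a set \<Rightarrow> ('a \<times> 'a) set \<Rightarrow> ('a \<Rightarrow> 'a \<Rightarrow> real) \<Rightarrow> bool" where
  "assumption_beta V E b \<longleftrightarrow>
     (\<forall>x\<in>V. (\<Sum>y\<in>out_nbrs E x. b x y) = (\<Sum>y\<in>in_nbrs E x. b y x))"

definition induced_edges :: "'a set \<Rightarrow> ('a \<times> 'a) set \<Rightarrow> ('a \<times> 'a) set" where
  "induced_edges W E = (W \<times> W) \<inter> E"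

(* Functions on V are represented by functions on the whole vertex type vanishing outside V. *)
definition funs_on :: "'a set \<Rightarrow> ('a \<Rightarrow> complex) set" where
  "funs_on V = {f. \<forall>x. x \<notin> V \<longrightarrow> f x = 0}"

definition inner_m :: "'a set \<Rightarrow> ('a \<Rightarrow> real) \<Rightarrow> ('a \<Rightarrow> complex) \<Rightarrow> ('a \<Rightarrow> complex) \<Rightarrow> complex" where
  "inner_m V m f g = (\<Sum>x\<in>V. of_real (m x) * f x * cnj (g x))"

definition sym_weight :: "('a \<Rightarrow> 'a \<Rightarrow> real) \<Rightarrow> 'a \<Rightarrow> 'a \<Rightarrow> real" where
  "sym_weight b x y = b x y + b y x"

definition special_laplacian ::
  "'a set \<Rightarrow> ('a \<times> 'a) set \<Rightarrow> ('a \<Rightarrow> 'a \<Rightarrow> real) \<Rightarrow> ('a \<Rightarrow> real) \<Rightarrow> ('a \<Rightarrow> complex) \<Rightarrow> 'a \<Rightarrow> complex" where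
  "special_laplacian V E b m f x =
     (if x \<in> V
      then 1 / of_real (m x) * (\<Sum>y\<in>nbrs E x. of_real (sym_weight b x y) * (f x - f y))
      else 0)"

(* Hence special_laplacian W (induced_edges W E) b m sums over the neighbours lying in W. *)
lemma nbrs_induced_edges: "x \<in> W \<Longrightarrow> nbrs (induced_edges W E) x = nbrs E x \<inter> W"
  by (auto simp: nbrs_def out_nbrs_def in_nbrs_def induced_edges_def)

interpretation cfun: vector_space "\<lambda>(c::complex) (f::'a \<Rightarrow> complex) x. c * f x"
  by unfold_locales (auto simp: fun_eq_iff algebra_simps)

definition eigenspace ::
  "'a set \<Rightarrow> (('a \<Rightarrow> complex) \<Rightarrow> 'a \<Rightarrow> complex) \<Rightarrow> complex \<Rightarrow> ('a \<Rightarrow> complex) set" where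
  "eigenspace V T \<mu> = {f \<in> funs_on V. T f = (\<lambda>x. \<mu> * f x)}"

(* Only real eigenvalues are listed; for the special Laplacian these are all the eigenvalues, see
   special_laplacian_eigenvalue_real below. *)
definition eigenvalue_list ::
  "'a set \<Rightarrow> (('a \<Rightarrow> complex) \<Rightarrow> 'a \<Rightarrow> complex) \<Rightarrow> real list" where
  "eigenvalue_list V T =
     concat (map (\<lambda>\<mu>. replicate (cfun.dim (eigenspace V T (of_real \<mu>))) \<mu>)
       (sorted_list_of_set {\<mu>. \<exists>f \<in> eigenspace V T (of_real \<mu>). f \<noteq> 0}))"

(* The enumeration of the eigenvalues starts at 1. *)
definition nth_eigenvalue ::
  "'a set \<Rightarrow> (('a \<Rightarrow> complex) \<Rightarrow> 'a \<Rightarrow> complex) \<Rightarrow> nat \<Rightarrow> real" where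
  "nth_eigenvalue V T k = eigenvalue_list V T ! (k - 1)"

context weighted_digraph
begin

lemma special_laplacian_eq:
  assumes "W \<subseteq> V" "x \<in> W"
  shows "special_laplacian W (induced_edges W E) b m f x =
    1 / of_real (m x) * (\<Sum>y\<in>W. of_real (sym_weight b x y) * (f x - f y))"
proof -
  have "sym_weight b x y = 0" if "y \<in> W - nbrs (induced_edges W E) x" for y
  proof -
    have "x \<in> V" "y \<in> V" "(x, y) \<notin> E" "(y, x) \<notin> E"
      using that assms by (auto simp: nbrs_def out_nbrs_def in_nbrs_def induced_edges_def)
    then have "b x y = 0" "b y x = 0"
      using b_nonneg b_pos_iff by (metis order_le_less)+
    then show ?thesis by (simp add: sym_weight_def)
  qed
  moreover have "nbrs (induced_edges W E) x \<subseteq> W" "finite W"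
    using assms finite_vertices finite_subset
    by (auto simp: nbrs_def out_nbrs_def in_nbrs_def induced_edges_def)
  ultimately have "(\<Sum>y\<in>nbrs (induced_edges W E) x. complex_of_real (sym_weight b x y) * (f x - f y))
      = (\<Sum>y\<in>W. of_real (sym_weight b x y) * (f x - f y))"
    by (intro sum.mono_neutral_left) auto
  then show ?thesis using assms by (simp add: special_laplacian_def)
qed

lemma special_laplacian_selfadjoint:
  assumes "W \<subseteq> V"
  shows "inner_m W m (special_laplacian W (induced_edges W E) b m f) g =
    inner_m W m f (special_laplacian W (induced_edges W E) b m g)"
proof -
  let ?a = "\<lambda>x y. complex_of_real (sym_weight b x y)"
  have m0: "m x \<noteq> 0" if "x \<in> W" for x using m_pos assms that by (metis less_irrefl subsetD)
  have sym: "(\<Sum>x\<in>W. \<Sum>y\<in>W. ?a x y * f y * cnj (g x)) = (\<Sum>x\<in>W. \<Sum>y\<in>W. ?a x y * f x * cnj (g y))"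
    by (subst sum.swap) (simp add: sym_weight_def add.commute)
  have "inner_m W m (special_laplacian W (induced_edges W E) b m f) g =
      (\<Sum>x\<in>W. \<Sum>y\<in>W. ?a x y * f x * cnj (g x) - ?a x y * f y * cnj (g x))"
    unfolding inner_m_def
    by (intro sum.cong refl)
      (simp add: special_laplacian_eq[OF assms] m0 sum_distrib_left sum_distrib_right algebra_simps)
  also have "\<dots> = (\<Sum>x\<in>W. \<Sum>y\<in>W. ?a x y * f x * cnj (g x) - ?a x y * f x * cnj (g y))"
    by (simp add: sum_subtractf sym)
  also have "\<dots> = inner_m W m f (special_laplacian W (induced_edges W E) b m g)"
    unfolding inner_m_def
    by (intro sum.cong refl)
      (simp add: special_laplacian_eq[OF assms] m0 sum_distrib_left sum_distrib_right algebra_simps)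
  finally show ?thesis .
qed

lemma special_laplacian_eigenvalue_real:
  assumes "W \<subseteq> V" "f \<in> eigenspace W (special_laplacian W (induced_edges W E) b m) \<mu>" "f \<noteq> 0"
  shows "\<mu> \<in> \<real>"
proof -
  have fin: "finite W" using assms(1) finite_vertices finite_subset by auto
  have on: "f x = 0" if "x \<notin> W" for x
    using assms(2) that by (auto simp: eigenspace_def funs_on_def)
  obtain z where z: "z \<in> W" "f z \<noteq> 0" using assms(3) on by (auto simp: fun_eq_iff)
  have "special_laplacian W (induced_edges W E) b m f = (\<lambda>x. \<mu> * f x)"
    using assms(2) by (simp add: eigenspace_def)
  with special_laplacian_selfadjoint[OF assms(1), of f f]
  have "\<mu> * inner_m W m f f = cnj \<mu> * inner_m W m f f"
    by (simp add: inner_m_def sum_distrib_left algebra_simps)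
  moreover have "inner_m W m f f \<noteq> 0"
  proof -
    have eq: "inner_m W m f f = of_real (\<Sum>x\<in>W. m x * (cmod (f x))\<^sup>2)"
      by (simp add: inner_m_def complex_norm_square mult.assoc del: of_real_power)
    have "0 < (\<Sum>x\<in>W. m x * (cmod (f x))\<^sup>2)"
    proof (rule sum_pos2[OF fin z(1)])
      show "0 < m z * (cmod (f z))\<^sup>2" using z m_pos assms(1) by auto
      show "0 \<le> m x * (cmod (f x))\<^sup>2" if "x \<in> W" for x
        using m_pos[of x] assms(1) that by auto
    qed
    with eq show ?thesis by (metis less_irrefl of_real_eq_0_iff)
  qed
  ultimately show ?thesis by (simp add: Reals_cnj_iff)
qed

end

end

(* Extension by zero embeds funs_on V_H isometrically into funs_on V_G and does not decrease the
   quadratic form. Put t = lambda_(n-r+k)(S_G). The eigenvectors of S_G with eigenvalue at most t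
   span a space of dimension at least n - r + k on which the form of S_G is at most t |f|^2. If
   lambda_k(S_H) > t, the eigenvectors of S_H with eigenvalue above t span a space of dimension at
   least r - k + 1 on which the form of S_H, hence that of S_G, exceeds t |f|^2 for nonzero f. The two
   spaces then meet only in 0, although their dimensions add up to more than n.
   Orthogonal eigenbases come from a largest orthogonal set of eigenvectors: its orthogonal
   complement is invariant, so if it were nonzero, a polynomial annihilating one of its vectors would
   split into linear factors over the complex numbers and yield one more eigenvector. *)

theory Submission
  imports Defs "HOL-Computational_Algebra.Fundamental_Theorem_Algebra"
begin

section \<open>The weighted inner product and orthogonal families\<close>

lemma sum_fun_apply: "(\<Sum>i\<in>A. F i) x = (\<Sum>i\<in>A. F i x)"
  by (induction A rule: infinite_finite_induct) auto

lemma inner_m_add_left: "inner_m W m (f + g) h = inner_m W m f h + inner_m W m g h"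
  by (simp add: inner_m_def algebra_simps sum.distrib)

lemma inner_m_scale_left: "inner_m W m (\<lambda>x. c * f x) h = c * inner_m W m f h"
  by (simp add: inner_m_def sum_distrib_left algebra_simps)

lemma inner_m_zero_left [simp]: "inner_m W m 0 h = 0"
  by (simp add: inner_m_def)

lemma inner_m_diff_left: "inner_m W m (f - g) h = inner_m W m f h - inner_m W m g h"
  by (simp add: inner_m_def algebra_simps sum_subtractf)

lemma inner_m_commute: "inner_m W m f g = cnj (inner_m W m g f)"
  by (simp add: inner_m_def mult_ac)

lemma inner_m_sum_left:
  fixes F :: "'i \<Rightarrow> 'a \<Rightarrow> complex"
  shows "inner_m W m (\<Sum>i\<in>A. F i) h = (\<Sum>i\<in>A. inner_m W m (F i) h)"
  using sum_comp_morphism[of "\<lambda>f. inner_m W m f h" F A]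
  by (simp add: inner_m_add_left o_def)

lemma inner_m_self: "inner_m W m f f = of_real (\<Sum>x\<in>W. m x * (cmod (f x))\<^sup>2)"
  by (simp add: inner_m_def complex_norm_square mult.assoc del: of_real_power)

lemma subspace_funs_on: "cfun.subspace (funs_on W)"
  by (auto simp: cfun.subspace_def funs_on_def)

text \<open>Excluding 0 makes such a family linearly independent once \<open>m\<close> is positive
  on a finite \<open>W\<close>, which in turn bounds its size.\<close>

definition orthogonal_in :: "'a set \<Rightarrow> ('a \<Rightarrow> real) \<Rightarrow> ('a \<Rightarrow> complex) set \<Rightarrow> bool" where
  "orthogonal_in W m B \<longleftrightarrow>
     finite B \<and> B \<subseteq> funs_on W \<and> 0 \<notin> B \<and> pairwise (\<lambda>f g. inner_m W m f g = 0) B"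

lemma orthogonal_in_subset: "orthogonal_in W m B \<Longrightarrow> C \<subseteq> B \<Longrightarrow> orthogonal_in W m C"
  by (auto simp: orthogonal_in_def pairwise_def intro: finite_subset)

text \<open>Pairing with \<open>v\<close> kills every term except its own. Independence, orthogonal
  projection and the description of eigenspaces all rest on reading off coefficients this
  way.\<close>

lemma orthogonal_in_coeff:
  assumes "orthogonal_in W m B" "v \<in> B"
  shows "inner_m W m (\<Sum>w\<in>B. (\<lambda>x. u w * w x)) v = u v * inner_m W m v v"
proof -
  have "inner_m W m (\<Sum>w\<in>B. (\<lambda>x. u w * w x)) v = (\<Sum>w\<in>B. u w * inner_m W m w v)"
    by (simp add: inner_m_sum_left inner_m_scale_left)
  also have "\<dots> = (\<Sum>w\<in>B. if w = v then u v * inner_m W m v v else 0)"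
    using assms by (intro sum.cong) (auto simp: orthogonal_in_def pairwise_def)
  also have "\<dots> = u v * inner_m W m v v"
    using assms by (simp add: orthogonal_in_def)
  finally show ?thesis .
qed

text \<open>Two coefficient families are allowed so that \<open>T f\<close> can stand on the left
  and \<open>f\<close> on the right when \<open>f\<close> is a combination of eigenvectors.\<close>

lemma orthogonal_in_norm:
  assumes "orthogonal_in W m B"
  shows "inner_m W m (\<Sum>w\<in>B. (\<lambda>x. u w * w x)) (\<Sum>w\<in>B. (\<lambda>x. v w * w x)) =
    (\<Sum>w\<in>B. u w * cnj (v w) * inner_m W m w w)"
proof -
  let ?f = "\<Sum>w\<in>B. (\<lambda>x. u w * w x)" and ?g = "\<Sum>w\<in>B. (\<lambda>x. v w * w x)"
  have "inner_m W m ?f ?g = (\<Sum>w\<in>B. u w * inner_m W m w ?g)"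
    by (simp add: inner_m_sum_left inner_m_scale_left)
  also have "\<dots> = (\<Sum>w\<in>B. u w * cnj (v w) * inner_m W m w w)"
  proof (intro sum.cong refl)
    fix w assume "w \<in> B"
    have "inner_m W m w ?g = cnj (v w * inner_m W m w w)"
      using orthogonal_in_coeff[OF assms \<open>w \<in> B\<close>, of v] inner_m_commute by metis
    then show "u w * inner_m W m w ?g = u w * cnj (v w) * inner_m W m w w"
      using inner_m_commute[of W m w w] by simp
  qed
  finally show ?thesis .
qed

section \<open>Positivity and dimension of the space of functions on a finite weighted set\<close>

locale weighted_finite_set =
  fixes W :: "'a set" and m :: "'a \<Rightarrow> real"
  assumes finite_W: "finite W" and m_pos_W: "x \<in> W \<Longrightarrow> m x > 0"
begin

lemma inner_m_pos:
  assumes "f \<in> funs_on W" "f \<noteq> 0"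
  shows "0 < Re (inner_m W m f f)"
proof -
  obtain z where z: "z \<in> W" "f z \<noteq> 0" using assms by (auto simp: fun_eq_iff funs_on_def)
  have "0 < (\<Sum>x\<in>W. m x * (cmod (f x))\<^sup>2)"
  proof (rule sum_pos2[OF finite_W z(1)])
    show "0 < m z * (cmod (f z))\<^sup>2" using z m_pos_W by auto
    show "0 \<le> m x * (cmod (f x))\<^sup>2" if "x \<in> W" for x
      using m_pos_W[of x] that by auto
  qed
  then show ?thesis by (simp only: inner_m_self Re_complex_of_real)
qed

lemma inner_m_nz: "f \<in> funs_on W \<Longrightarrow> f \<noteq> 0 \<Longrightarrow> inner_m W m f f \<noteq> 0"
  using inner_m_pos by fastforce

text \<open>Pairing a vanishing combination with \<open>v\<close> leaves \<open>u v\<close> times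
  the nonzero number \<open>inner_m W m v v\<close>.\<close>

lemma orthogonal_in_independent:
  assumes "orthogonal_in W m B"
  shows "cfun.independent B"
proof -
  have "u v = 0" if "(\<Sum>w\<in>B. (\<lambda>x. u w * w x)) = 0" "v \<in> B" for u v
  proof -
    have "u v * inner_m W m v v = 0"
      using orthogonal_in_coeff[OF assms that(2), of u] that(1) by simp
    moreover have "inner_m W m v v \<noteq> 0"
      using inner_m_nz that(2) assms by (metis orthogonal_in_def subsetD)
    ultimately show ?thesis by simp
  qed
  moreover have "finite B" using assms by (simp add: orthogonal_in_def)
  ultimately show ?thesis by (auto simp: cfun.dependent_finite)
qed

text \<open>The indicators of single points are an explicit basis, which fixes the dimension of
  \<open>funs_on W\<close> as \<open>card W\<close>.\<close>

lemma point_masses: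
  defines "D \<equiv> (\<lambda>y x. if x = y then 1 else 0 :: complex) ` W"
  shows "orthogonal_in W m D" and "card D = card W" and "cfun.span D = funs_on W"
proof -
  show "orthogonal_in W m D"
    unfolding orthogonal_in_def D_def pairwise_def funs_on_def inner_m_def
    by (auto simp: finite_W fun_eq_iff intro!: sum.neutral split: if_splits)
  have inj: "inj_on (\<lambda>y x. if x = y then 1 else 0 :: complex) W"
    by (auto simp: inj_on_def fun_eq_iff split: if_splits)
  then show "card D = card W" by (simp add: D_def card_image)
  have "f \<in> cfun.span D" if "f \<in> funs_on W" for f
  proof -
    have "f = (\<Sum>y\<in>W. (\<lambda>x. f y * (if x = y then 1 else 0)))"
      using that finite_W by (auto simp: fun_eq_iff sum_fun_apply funs_on_def if_distrib cong: if_cong)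
    also have "\<dots> \<in> cfun.span D"
      by (intro cfun.span_sum cfun.span_scale cfun.span_base) (auto simp: D_def)
    finally show ?thesis .
  qed
  moreover have "cfun.span D \<subseteq> funs_on W"
    by (intro cfun.span_minimal subspace_funs_on) (auto simp: D_def funs_on_def)
  ultimately show "cfun.span D = funs_on W" by blast
qed

lemma independent_card_le:
  assumes "cfun.independent B" "B \<subseteq> funs_on W"
  shows "finite B \<and> card B \<le> card W"
proof -
  let ?D = "(\<lambda>y x. if x = y then 1 else 0 :: complex) ` W"
  have "finite ?D" using finite_W by simp
  from cfun.independent_span_bound[OF this assms(1)] show ?thesis
    using assms(2) point_masses by simp
qed

text \<open>The exchange bound is used in both directions, between \<open>B\<close> and the point
  masses: each is independent and each spans \<open>funs_on W\<close>.\<close>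

lemma orthogonal_in_card_eq:
  assumes "orthogonal_in W m B" "cfun.span B = funs_on W"
  shows "card B = card W"
proof (rule antisym)
  let ?D = "(\<lambda>y x. if x = y then 1 else 0 :: complex) ` W"
  show "card B \<le> card W"
    using independent_card_le orthogonal_in_independent assms(1) by (simp add: orthogonal_in_def)
  have "finite B" using assms(1) by (simp add: orthogonal_in_def)
  from cfun.independent_span_bound[OF this orthogonal_in_independent[OF point_masses(1)]]
  have "card ?D \<le> card B"
    using assms(2) point_masses(1) by (simp add: orthogonal_in_def)
  then show "card W \<le> card B" using point_masses(2) by simp
qed

end

section \<open>Symmetric operators and polynomials in them\<close>

locale symmetric_operator = weighted_finite_set W m
  for W :: "'a set" and m :: "'a \<Rightarrow> real" +
  fixes T :: "('a \<Rightarrow> complex) \<Rightarrow> 'a \<Rightarrow> complex"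
  assumes T_add: "T (f + g) = T f + T g"
    and T_scale: "T (\<lambda>x. c * f x) = (\<lambda>x. c * T f x)"
    and T_funs_on: "T f \<in> funs_on W"
    and T_symmetric: "inner_m W m (T f) g = inner_m W m f (T g)"
begin

lemma T_zero: "T 0 = 0"
  using T_scale[of 0 0] by (simp add: fun_eq_iff zero_fun_def)

lemma T_sum: "T (\<Sum>i\<in>A. F i) = (\<Sum>i\<in>A. T (F i))"
  using sum_comp_morphism[of T F A, OF T_zero T_add] by (simp add: o_def)

text \<open>This is the vector p(T) f.\<close>

definition poly_op :: "complex poly \<Rightarrow> ('a \<Rightarrow> complex) \<Rightarrow> 'a \<Rightarrow> complex" where
  "poly_op p f = (\<Sum>i\<le>degree p. (\<lambda>x. coeff p i * (T ^^ i) f x))"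

text \<open>A common summation range allows polynomials of different degrees to be compared term by
  term.\<close>

lemma poly_op_bound:
  assumes "degree p \<le> N"
  shows "poly_op p f = (\<Sum>i\<le>N. (\<lambda>x. coeff p i * (T ^^ i) f x))"
  unfolding poly_op_def using assms
  by (intro sum.mono_neutral_left) (auto simp: coeff_eq_0 fun_eq_iff)

text \<open>With X the indeterminate, the product is X q - c q. The coefficient shift
  \<open>pCons 0 q\<close>, which is X q, amounts to one more application of
  \<open>T\<close>.\<close>

lemma poly_op_linear_factor:
  "poly_op ([:- c, 1:] * q) f = T (poly_op q f) - (\<lambda>x. c * poly_op q f x)"
proof -
  let ?N = "degree q"
  have coeff: "coeff ([:- c, 1:] * q) i = coeff (pCons 0 q) i - c * coeff q i" for i
    by simp
  have "degree ([:- c, 1:] * q) \<le> Suc ?N"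
    using degree_mult_le[of "[:- c, 1:]" q] by simp
  then have "poly_op ([:- c, 1:] * q) f =
      (\<Sum>i\<le>Suc ?N. (\<lambda>x. coeff ([:- c, 1:] * q) i * (T ^^ i) f x))"
    by (rule poly_op_bound)
  also have "\<dots> = (\<Sum>i\<le>Suc ?N. (\<lambda>x. coeff (pCons 0 q) i * (T ^^ i) f x)) -
      (\<Sum>i\<le>Suc ?N. (\<lambda>x. c * (coeff q i * (T ^^ i) f x)))"
    unfolding sum_subtractf[symmetric]
    by (intro sum.cong refl ext) (simp only: coeff minus_apply left_diff_distrib mult.assoc)
  also have "(\<Sum>i\<le>Suc ?N. (\<lambda>x. c * (coeff q i * (T ^^ i) f x))) = (\<lambda>x. c * poly_op q f x)"
    unfolding poly_op_bound[of q "Suc ?N", OF le_SucI[OF order_refl]]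
    by (simp only: fun_eq_iff sum_fun_apply sum_distrib_left) simp
  also have "(\<Sum>i\<le>Suc ?N. (\<lambda>x. coeff (pCons 0 q) i * (T ^^ i) f x)) = T (poly_op q f)"
    unfolding poly_op_def T_sum T_scale sum.atMost_Suc_shift by (simp add: fun_eq_iff sum_fun_apply)
  finally show ?thesis .
qed

section \<open>Eigenvectors in invariant subspaces\<close>

context
  fixes U :: "('a \<Rightarrow> complex) set"
  assumes U_subspace: "cfun.subspace U" and U_funs_on: "U \<subseteq> funs_on W"
    and U_invariant: "f \<in> U \<Longrightarrow> T f \<in> U"
begin

lemma iterate_in: "f \<in> U \<Longrightarrow> (T ^^ i) f \<in> U"
  by (induction i) (auto intro: U_invariant)

lemma poly_op_in: "f \<in> U \<Longrightarrow> poly_op p f \<in> U"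
  unfolding poly_op_def
  by (intro cfun.subspace_sum[OF U_subspace] cfun.subspace_scale[OF U_subspace] iterate_in)

text \<open>Induction on the degree: split off a root, p = (X - c) q. Either q(T) f = 0 and
  \<open>q\<close> has smaller degree, or q(T) f is itself an eigenvector for \<open>c\<close>, and
  it stays in \<open>U\<close> by invariance.\<close>

lemma eigenvector_of_poly_op:
  assumes "p \<noteq> 0" "f \<in> U" "f \<noteq> 0" "poly_op p f = 0"
  shows "\<exists>c. \<exists>g\<in>U. g \<noteq> 0 \<and> T g = (\<lambda>x. c * g x)"
  using assms
proof (induction "degree p" arbitrary: p)
  case 0
  then obtain a where a: "p = [:a:]" "a \<noteq> 0" by (metis degree_eq_zeroE pCons_0_0)
  then have "f = 0" using 0 by (simp add: poly_op_def fun_eq_iff)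
  then show ?case using 0 by simp
next
  case (Suc d)
  have "\<not> constant (poly p)" using Suc(2) by (simp add: constant_degree)
  then obtain c where "poly p c = 0" using fundamental_theorem_of_algebra by blast
  then obtain q where q: "p = [:- c, 1:] * q" by (auto simp: poly_eq_0_iff_dvd dvd_def)
  then have q0: "q \<noteq> 0" using Suc by auto
  have "degree p = degree [:- c, 1:] + degree q"
    unfolding q by (rule degree_mult_eq) (use q0 in auto)
  then have deg: "d = degree q" using Suc(2) by simp
  show ?case
  proof (cases "poly_op q f = 0")
    case True
    then show ?thesis using Suc(1)[OF deg q0] Suc by blast
  next
    case False
    have "T (poly_op q f) = (\<lambda>x. c * poly_op q f x)"
      using Suc(6) q poly_op_linear_factor[of c q f] by (simp add: fun_eq_iff)
    then show ?thesis using False poly_op_in[OF \<open>f \<in> U\<close>] by blast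
  qed
qed

text \<open>The first \<open>card W + 1\<close> iterates of \<open>f\<close> lie in a space of
  dimension \<open>card W\<close>. A linear relation between them is a nonzero polynomial
  annihilating \<open>f\<close>.\<close>

lemma eigenvector_exists:
  assumes "f \<in> U" "f \<noteq> 0"
  shows "\<exists>c. \<exists>g\<in>U. g \<noteq> 0 \<and> T g = (\<lambda>x. c * g x)"
proof -
  let ?N = "card W"
  let ?F = "\<lambda>i. (T ^^ i) f"
  have "\<exists>u. (\<exists>i\<le>?N. u i \<noteq> 0) \<and> (\<Sum>i\<le>?N. (\<lambda>x. u i * ?F i x)) = 0"
  \<comment> \<open>Dependence is a property of the set of iterates and does not see repetitions, so
    equal iterates are treated separately.\<close>
  proof (cases "inj_on ?F {..?N}")
    case True
    have "?F ` {..?N} \<subseteq> funs_on W" using iterate_in[OF assms(1)] U_funs_on by blast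
    moreover have "card (?F ` {..?N}) = Suc ?N" using card_image[OF True] by simp
    ultimately have "cfun.dependent (?F ` {..?N})" using independent_card_le by force
    then obtain u where u: "\<exists>v\<in>?F ` {..?N}. u v \<noteq> 0"
        "(\<Sum>v\<in>?F ` {..?N}. (\<lambda>x. u v * v x)) = 0"
      by (auto simp: cfun.dependent_finite)
    have "(\<Sum>i\<le>?N. (\<lambda>x. u (?F i) * ?F i x)) = 0"
      using u(2) unfolding sum.reindex[OF True] by (simp add: o_def)
    then show ?thesis using u(1) by (intro exI[of _ "\<lambda>i. u (?F i)"]) auto
  next
    case False
    then obtain i j where ij: "i \<le> ?N" "j \<le> ?N" "i \<noteq> j" "?F i = ?F j" by (auto simp: inj_on_def)
    \<comment> \<open>Coefficient 1 at \<open>i\<close> and -1 at \<open>j\<close> expresses that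
      the two iterates have difference 0.\<close>
    let ?u = "\<lambda>l. (if l = i then 1 else 0) - (if l = j then 1 else 0 :: complex)"
    have "(\<Sum>l\<le>?N. (\<lambda>x. ?u l * ?F l x)) = 0"
      using ij by (simp add: fun_eq_iff sum_fun_apply left_diff_distrib sum_subtractf
          if_distrib[of "\<lambda>z. z * _"] cong: if_cong)
    moreover have "?u i \<noteq> 0" using ij by simp
    ultimately show ?thesis using ij(1) by (intro exI[of _ ?u] conjI exI[of _ i])
  qed
  then obtain u i where u: "i \<le> ?N" "u i \<noteq> 0" "(\<Sum>i\<le>?N. (\<lambda>x. u i * ?F i x)) = 0" by blast
  define p where "p = (\<Sum>i\<le>?N. monom (u i) i)"
  have coeff: "coeff p l = (if l \<le> ?N then u l else 0)" for l
    by (simp add: p_def coeff_sum coeff_monom)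
  then have "p \<noteq> 0" using u(1,2) by (metis coeff_0)
  moreover have "degree p \<le> ?N" by (intro degree_le) (simp add: coeff)
  then have "poly_op p f = (\<Sum>i\<le>?N. (\<lambda>x. u i * ?F i x))"
    unfolding poly_op_bound[OF \<open>degree p \<le> ?N\<close>] by (intro sum.cong refl) (simp add: coeff)
  then have "poly_op p f = 0" using u(3) by simp
  ultimately show ?thesis using eigenvector_of_poly_op assms by blast
qed

end

section \<open>Real eigenvalues and orthogonal eigenbases\<close>

lemma eigenvalue_real:
  assumes "f \<in> funs_on W" "f \<noteq> 0" "T f = (\<lambda>x. c * f x)"
  shows "c = of_real (Re c)"
proof -
  have "inner_m W m f (T f) = cnj (inner_m W m (T f) f)" by (rule inner_m_commute)
  then have "c * inner_m W m f f = cnj c * cnj (inner_m W m f f)"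
    using T_symmetric[of f f] by (simp add: assms(3) inner_m_scale_left)
  \<comment> \<open>The inner product of \<open>f\<close> with itself is real and nonzero, hence
    cancels.\<close>
  then have "c = cnj c"
    using inner_m_commute[of W m f f] inner_m_nz[OF assms(1,2)] by simp
  then show ?thesis by (simp add: complex_eq_iff)
qed

definition eigenbasis :: "('a \<Rightarrow> complex) set \<Rightarrow> (('a \<Rightarrow> complex) \<Rightarrow> real) \<Rightarrow> bool" where
  "eigenbasis B e \<longleftrightarrow> orthogonal_in W m B \<and> cfun.span B = funs_on W \<and>
     (\<forall>v\<in>B. T v = (\<lambda>x. of_real (e v) * v x))"

lemma eigenbasis_exists: "\<exists>B e. eigenbasis B e"
proof -
  let ?Q = "\<lambda>B. orthogonal_in W m B \<and> (\<forall>v\<in>B. \<exists>c. T v = (\<lambda>x. c * v x))"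
  have "?Q {}" by (simp add: orthogonal_in_def pairwise_def)
  moreover have "\<forall>B. ?Q B \<longrightarrow> card B < Suc (card W)"
    using independent_card_le orthogonal_in_independent by (auto simp: orthogonal_in_def less_Suc_eq_le)
  ultimately have "\<exists>B. ?Q B \<and> (\<forall>C. ?Q C \<longrightarrow> card C \<le> card B)"
    by (rule ex_has_greatest_nat)
  then obtain B where B: "?Q B" and max: "\<And>C. ?Q C \<Longrightarrow> card C \<le> card B"
    by blast
  \<comment> \<open>The orthogonal complement of \<open>B\<close>. It is invariant because moving
    \<open>T\<close> onto an eigenvector \<open>v\<close> only produces a multiple of
    \<open>v\<close>.\<close>
  define U where "U = {f \<in> funs_on W. \<forall>v\<in>B. inner_m W m f v = 0}"
  have "cfun.subspace U"
    using subspace_funs_on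
    by (auto simp: U_def cfun.subspace_def inner_m_add_left inner_m_scale_left)
  moreover have "U \<subseteq> funs_on W" by (auto simp: U_def)
  moreover have "T f \<in> U" if "f \<in> U" for f
  proof -
    have "inner_m W m (T f) v = 0" if v: "v \<in> B" for v
    proof -
      obtain c where "T v = (\<lambda>x. c * v x)" using B v by blast
      then have "inner_m W m (T f) v = cnj (c * inner_m W m v f)"
        by (metis T_symmetric inner_m_commute inner_m_scale_left)
      also have "inner_m W m v f = 0"
        using \<open>f \<in> U\<close> v inner_m_commute[of W m v f] by (simp add: U_def)
      finally show ?thesis by simp
    qed
    then show ?thesis using T_funs_on by (simp add: U_def)
  qed
  ultimately have ev: "\<exists>c. \<exists>g\<in>U. g \<noteq> 0 \<and> T g = (\<lambda>x. c * g x)" if "f \<in> U" "f \<noteq> 0" for f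
    using eigenvector_exists that by blast
  \<comment> \<open>An eigenvector \<open>g\<close> in \<open>U\<close> could be added to
    \<open>B\<close>. As \<open>B\<close> has the largest size, \<open>g\<close> already lies in
    \<open>B\<close>, so it is orthogonal to itself.\<close>
  have U0: "f = 0" if "f \<in> U" for f
  proof (rule ccontr)
    assume "f \<noteq> 0"
    then obtain c g where g: "g \<in> U" "g \<noteq> 0" "T g = (\<lambda>x. c * g x)" using ev \<open>f \<in> U\<close> by blast
    have "inner_m W m v g = 0" if "v \<in> B" for v
      using that g(1) inner_m_commute[of W m v g] by (simp add: U_def)
    then have "?Q (insert g B)"
      using B g by (auto simp: orthogonal_in_def U_def pairwise_insert)
    then have "card (insert g B) \<le> card B" by (rule max)
    moreover have "finite B" using B by (simp add: orthogonal_in_def)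
    ultimately have "g \<in> B" by (metis card_insert_disjoint not_less_eq_eq order_refl)
    then have "inner_m W m g g = 0" using g(1) by (simp add: U_def)
    then show False using inner_m_nz g by (auto simp: U_def)
  qed
  have "f \<in> cfun.span B" if f: "f \<in> funs_on W" for f
  proof -
    \<comment> \<open>The orthogonal projection of \<open>f\<close> onto the span of
      \<open>B\<close>; the remainder \<open>f - h\<close> falls into \<open>U\<close> and
      vanishes.\<close>
    define h where "h = (\<Sum>v\<in>B. (\<lambda>x. (inner_m W m f v / inner_m W m v v) * v x))"
    have h: "h \<in> cfun.span B" unfolding h_def
      by (intro cfun.span_sum cfun.span_scale cfun.span_base)
    have "h \<in> funs_on W" unfolding h_def
      using B by (intro cfun.subspace_sum[OF subspace_funs_on] cfun.subspace_scale[OF subspace_funs_on])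
        (auto simp: orthogonal_in_def)
    then have "f - h \<in> funs_on W" using f cfun.subspace_diff subspace_funs_on by blast
    moreover have "inner_m W m (f - h) v = 0" if v: "v \<in> B" for v
    proof -
      have "inner_m W m v v \<noteq> 0"
        using inner_m_nz v B by (metis orthogonal_in_def subsetD)
      then show ?thesis
        using orthogonal_in_coeff[of W m B v "\<lambda>v. inner_m W m f v / inner_m W m v v"] B v
        by (simp add: inner_m_diff_left h_def)
    qed
    ultimately have "f - h \<in> U" by (simp add: U_def)
    then have "f - h = 0" by (rule U0)
    then show ?thesis using h by simp
  qed
  moreover have "cfun.span B \<subseteq> funs_on W"
    using B by (intro cfun.span_minimal subspace_funs_on) (auto simp: orthogonal_in_def)
  ultimately have span: "cfun.span B = funs_on W" by blast
  have "\<forall>v\<in>B. \<exists>c::real. T v = (\<lambda>x. of_real c * v x)"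
    using B eigenvalue_real by (metis orthogonal_in_def subsetD)
  then obtain e where "\<forall>v\<in>B. T v = (\<lambda>x. of_real (e v) * v x)" by metis
  then show ?thesis using B span by (auto simp: eigenbasis_def)
qed

section \<open>The eigenvalue list and the quadratic form in terms of an eigenbasis\<close>

context
  fixes B e
  assumes basis: "eigenbasis B e"
begin

lemma basis_orthogonal: "orthogonal_in W m B"
  using basis by (simp add: eigenbasis_def)

lemma finite_basis: "finite B"
  using basis_orthogonal by (simp add: orthogonal_in_def)

lemma basis_eigenvector: "v \<in> B \<Longrightarrow> T v = (\<lambda>x. of_real (e v) * v x)"
  using basis by (simp add: eigenbasis_def)

lemma T_combination:
  assumes "C \<subseteq> B"
  shows "T (\<Sum>v\<in>C. (\<lambda>x. u v * v x)) = (\<Sum>v\<in>C. (\<lambda>x. (of_real (e v) * u v) * v x))"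
  unfolding T_sum T_scale using assms
  by (intro sum.cong refl) (auto simp: basis_eigenvector fun_eq_iff subset_iff)

lemma combination_in_funs_on:
  assumes "C \<subseteq> B"
  shows "(\<Sum>v\<in>C. (\<lambda>x. u v * v x)) \<in> funs_on W"
  using assms basis_orthogonal
  by (intro cfun.subspace_sum[OF subspace_funs_on] cfun.subspace_scale[OF subspace_funs_on])
    (auto simp: orthogonal_in_def)

text \<open>Evaluating the inner product of \<open>T f\<close> with a basis vector \<open>v\<close>
  in two ways gives \<open>e v * u v = \<mu> * u v\<close> for the coefficient \<open>u v\<close> of
  \<open>f\<close>, so only basis vectors with eigenvalue \<open>\<mu>\<close> occur.\<close>

lemma eigenspace_eq_span:
  "eigenspace W T (of_real \<mu>) = cfun.span {v\<in>B. e v = \<mu>}"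
proof (intro subset_antisym subsetI)
  fix f assume f: "f \<in> eigenspace W T (of_real \<mu>)"
  then have "f \<in> cfun.span B" using basis by (simp add: eigenbasis_def eigenspace_def)
  then obtain u where u: "f = (\<Sum>v\<in>B. (\<lambda>x. u v * v x))"
    using cfun.span_finite[OF finite_basis] by auto
  have "u v = 0" if v: "v \<in> B" "e v \<noteq> \<mu>" for v
  proof -
    have "inner_m W m (T f) v = of_real (e v) * u v * inner_m W m v v"
      unfolding u T_combination[OF order_refl] by (rule orthogonal_in_coeff[OF basis_orthogonal v(1)])
    moreover have "inner_m W m (T f) v = of_real \<mu> * (u v * inner_m W m v v)"
      using f orthogonal_in_coeff[OF basis_orthogonal v(1), of u]
      by (simp add: eigenspace_def inner_m_scale_left u)
    moreover have "inner_m W m v v \<noteq> 0"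
      using inner_m_nz v basis_orthogonal by (metis orthogonal_in_def subsetD)
    ultimately show ?thesis using v by simp
  qed
  then have "f = (\<Sum>v\<in>{v\<in>B. e v = \<mu>}. (\<lambda>x. u v * v x))"
    unfolding u using finite_basis by (intro sum.mono_neutral_right) (auto simp: fun_eq_iff)
  then show "f \<in> cfun.span {v\<in>B. e v = \<mu>}"
    by (simp only:) (intro cfun.span_sum cfun.span_scale cfun.span_base)
next
  fix f assume f: "f \<in> cfun.span {v\<in>B. e v = \<mu>}"
  moreover have "finite {v\<in>B. e v = \<mu>}" using finite_basis by simp
  ultimately obtain u where u: "f = (\<Sum>v\<in>{v\<in>B. e v = \<mu>}. (\<lambda>x. u v * v x))"
    using cfun.span_finite by auto
  have C: "{v\<in>B. e v = \<mu>} \<subseteq> B" by blast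
  have "T f = (\<lambda>x. of_real \<mu> * f x)"
    unfolding u T_combination[OF C]
    by (rule ext, simp only: sum_fun_apply sum_distrib_left) (auto intro!: sum.cong)
  then show "f \<in> eigenspace W T (of_real \<mu>)"
    using combination_in_funs_on[OF C] by (simp add: eigenspace_def u)
qed

lemma dim_eigenspace: "cfun.dim (eigenspace W T (of_real \<mu>)) = card {v\<in>B. e v = \<mu>}"
proof -
  have "cfun.independent {v\<in>B. e v = \<mu>}"
    by (intro orthogonal_in_independent orthogonal_in_subset[OF basis_orthogonal]) auto
  then show ?thesis by (simp add: eigenspace_eq_span cfun.dim_eq_card_independent)
qed

lemma spectrum_eq: "{\<mu>. \<exists>f \<in> eigenspace W T (of_real \<mu>). f \<noteq> 0} = e ` B"
proof (intro subset_antisym subsetI)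
  fix \<mu> assume "\<mu> \<in> {\<mu>. \<exists>f \<in> eigenspace W T (of_real \<mu>). f \<noteq> 0}"
  then have "{v\<in>B. e v = \<mu>} \<noteq> {}" by (auto simp: eigenspace_eq_span simp del: Collect_empty_eq)
  then show "\<mu> \<in> e ` B" by auto
next
  fix \<mu> assume "\<mu> \<in> e ` B"
  then obtain v where v: "v \<in> B" "\<mu> = e v" by blast
  then have "v \<in> eigenspace W T (of_real \<mu>)"
    unfolding eigenspace_eq_span by (intro cfun.span_base) simp
  moreover have "v \<noteq> 0" using v basis_orthogonal by (auto simp: orthogonal_in_def)
  ultimately show "\<mu> \<in> {\<mu>. \<exists>f \<in> eigenspace W T (of_real \<mu>). f \<noteq> 0}" by blast
qed

text \<open>Each value of \<open>e\<close> is listed as often as it is attained on \<open>B\<close>.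
  Counting with a predicate relates list and basis without matching positions to vectors;
  \<open>P\<close> is later constantly true, "at most \<open>\<tau>\<close>" or "above
  \<open>\<tau>\<close>".\<close>

lemma length_filter_eigenvalue_list:
  "length (filter P (eigenvalue_list W T)) = card {v\<in>B. P (e v)}"
proof -
  let ?S = "e ` B"
  have fin: "finite ?S" using finite_basis by simp
  have "length (filter P (eigenvalue_list W T)) =
      (\<Sum>\<mu>\<leftarrow>sorted_list_of_set ?S. if P \<mu> then card {v\<in>B. e v = \<mu>} else 0)"
    unfolding eigenvalue_list_def spectrum_eq dim_eigenspace
    by (simp add: filter_concat length_concat filter_replicate o_def if_distrib cong: if_cong)
  also have "\<dots> = (\<Sum>\<mu>\<in>?S. if P \<mu> then card {v\<in>B. e v = \<mu>} else 0)"
    using fin by (simp add: sum_list_distinct_conv_sum_set)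
  \<comment> \<open>The summands become the fibres of \<open>e\<close> on the basis vectors selected
    by \<open>P\<close>, which \<open>sum.group\<close> adds up.\<close>
  also have "\<dots> = (\<Sum>\<mu>\<in>?S. card {v\<in>{v\<in>B. P (e v)}. e v = \<mu>})"
  proof (intro sum.cong refl)
    fix \<mu> assume "\<mu> \<in> ?S"
    have "{v\<in>{v\<in>B. P (e v)}. e v = \<mu>} = (if P \<mu> then {v\<in>B. e v = \<mu>} else {})" by auto
    then show "(if P \<mu> then card {v\<in>B. e v = \<mu>} else 0) = card {v\<in>{v\<in>B. P (e v)}. e v = \<mu>}"
      by simp
  qed
  also have "\<dots> = card {v\<in>B. P (e v)}"
    unfolding card_eq_sum using finite_basis by (intro sum.group) auto
  finally show ?thesis .
qed

lemma length_eigenvalue_list: "length (eigenvalue_list W T) = card W"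
  using length_filter_eigenvalue_list[of "\<lambda>_. True"] orthogonal_in_card_eq basis
  by (simp add: eigenbasis_def)

lemma sorted_eigenvalue_list: "sorted (eigenvalue_list W T)"
proof -
  have "sorted (concat (map (\<lambda>\<mu>. replicate (h \<mu>) \<mu>) xs))" if "sorted xs" for h and xs :: "real list"
    using that by (induction xs) (auto simp: sorted_append)
  then show ?thesis by (simp add: eigenvalue_list_def)
qed

text \<open>By orthogonality the squared norm is the sum of the weights \<open>?q v\<close>, and the
  form is the sum of \<open>e v * ?q v\<close>. The weights are nonnegative, so both bounds compare
  \<open>e v\<close> with \<open>\<tau>\<close> termwise.\<close>

lemma inner_m_combination_bounds:
  assumes "C \<subseteq> B" and f: "f = (\<Sum>v\<in>C. (\<lambda>x. u v * v x))"
  shows "(\<And>v. v \<in> C \<Longrightarrow> e v \<le> \<tau>) \<Longrightarrow>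
      Re (inner_m W m (T f) f) \<le> \<tau> * Re (inner_m W m f f)"
    and "(\<And>v. v \<in> C \<Longrightarrow> \<tau> < e v) \<Longrightarrow> f \<noteq> 0 \<Longrightarrow>
      \<tau> * Re (inner_m W m f f) < Re (inner_m W m (T f) f)"
proof -
  let ?q = "\<lambda>v. (cmod (u v))\<^sup>2 * Re (inner_m W m v v)"
  have C: "orthogonal_in W m C" using basis_orthogonal assms(1) by (rule orthogonal_in_subset)
  have q: "0 \<le> ?q v" if "v \<in> C" for v
  proof -
    have "v \<in> funs_on W" "v \<noteq> 0" using C that by (auto simp: orthogonal_in_def)
    then show ?thesis using inner_m_pos[of v] by simp
  qed
  have norm: "Re (inner_m W m f f) = (\<Sum>v\<in>C. ?q v)"
    unfolding f orthogonal_in_norm[OF C]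
    by (simp add: complex_mult_cnj cmod_power2)
  have form: "Re (inner_m W m (T f) f) = (\<Sum>v\<in>C. e v * ?q v)"
    unfolding f T_combination[OF assms(1)] orthogonal_in_norm[OF C]
    by (simp add: mult.assoc complex_mult_cnj cmod_power2)
  show "Re (inner_m W m (T f) f) \<le> \<tau> * Re (inner_m W m f f)"
    if "\<And>v. v \<in> C \<Longrightarrow> e v \<le> \<tau>"
    unfolding norm form sum_distrib_left using that q by (intro sum_mono mult_right_mono) auto
  show "\<tau> * Re (inner_m W m f f) < Re (inner_m W m (T f) f)"
    if lt: "\<And>v. v \<in> C \<Longrightarrow> \<tau> < e v" and "f \<noteq> 0"
  proof -
    have "f \<in> funs_on W" unfolding f by (rule combination_in_funs_on[OF assms(1)])
    then have "0 < (\<Sum>v\<in>C. ?q v)" using inner_m_pos \<open>f \<noteq> 0\<close> norm by metis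
    \<comment> \<open>A positive squared norm forces a positive weight, and this one term makes the
      inequality strict.\<close>
    then obtain w where w: "w \<in> C" "0 < ?q w" by (metis (no_types, lifting) linorder_not_less sum_nonpos)
    show ?thesis
      unfolding norm form sum_distrib_left
    proof (rule sum_strict_mono_ex1)
      show "finite C" using C by (simp add: orthogonal_in_def)
      show "\<forall>v\<in>C. \<tau> * ?q v \<le> e v * ?q v"
        using lt q by (intro ballI mult_right_mono) (auto intro: less_imp_le)
      show "\<exists>v\<in>C. \<tau> * ?q v < e v * ?q v"
        using w lt by (intro bexI[of _ w] mult_strict_right_mono) auto
    qed
  qed
qed

end

end

section \<open>Counting entries of sorted lists\<close>

lemma sorted_count_le_nth:
  assumes "sorted (xs :: real list)" "i < length xs"
  shows "Suc i \<le> length (filter (\<lambda>y. y \<le> xs ! i) xs)"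
proof -
  \<comment> \<open>Later entries may tie with \<open>xs ! i\<close>, so this is an inclusion and
    the count only a lower bound.\<close>
  have "{..i} \<subseteq> {j. j < length xs \<and> xs ! j \<le> xs ! i}"
    using assms by (auto simp: sorted_iff_nth_mono)
  then have "card {..i} \<le> card {j. j < length xs \<and> xs ! j \<le> xs ! i}" by (intro card_mono) auto
  then show ?thesis by (simp add: length_filter_conv_card)
qed

lemma sorted_count_gt:
  assumes "sorted (xs :: real list)" "i < length xs" "c < xs ! i"
  shows "length xs - i \<le> length (filter (\<lambda>y. c < y) xs)"
proof -
  have "c < xs ! j" if "i \<le> j" "j < length xs" for j
    using assms that by (meson sorted_nth_mono less_le_trans)
  then have "{i..<length xs} \<subseteq> {j. j < length xs \<and> c < xs ! j}" by auto
  then have "card {i..<length xs} \<le> card {j. j < length xs \<and> c < xs ! j}"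
    by (intro card_mono) auto
  then show ?thesis by (simp add: length_filter_conv_card)
qed

section \<open>The special Laplacian as a symmetric operator and extension by zero\<close>

context weighted_digraph
begin

text \<open>The operator reads \<open>f\<close> only on \<open>W\<close> and returns 0 outside, so
  the conditions hold for all functions on the vertex type. The choice \<open>W = V\<close> covers
  the whole graph.\<close>

lemma symmetric_operator_special_laplacian:
  assumes "W \<subseteq> V"
  shows "symmetric_operator W m (special_laplacian W (induced_edges W E) b m)"
proof
  show "finite W" using assms finite_vertices finite_subset by blast
  show "m x > 0" if "x \<in> W" for x using assms that m_pos by blast
next
  fix f g :: "'a \<Rightarrow> complex" and c :: complex
  let ?S = "special_laplacian W (induced_edges W E) b m"
  show "?S (f + g) = ?S f + ?S g"
    by (auto simp: fun_eq_iff special_laplacian_def algebra_simps sum.distrib sum_subtractf)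
  show "?S (\<lambda>x. c * f x) = (\<lambda>x. c * ?S f x)"
    by (auto simp: fun_eq_iff special_laplacian_def sum_distrib_left algebra_simps)
  show "?S f \<in> funs_on W" by (simp add: funs_on_def special_laplacian_def)
  show "inner_m W m (?S f) g = inner_m W m f (?S g)"
    by (rule special_laplacian_selfadjoint[OF assms])
qed

text \<open>Extending \<open>f\<close> by zero to \<open>V\<close> only adds the nonnegative boundary terms
  \<open>a x y * (cmod (f x))\<^sup>2\<close> with \<open>x \<in> W\<close> and \<open>y \<in> V - W\<close>.\<close>

lemma special_laplacian_form_mono:
  assumes "W \<subseteq> V" "f \<in> funs_on W"
  shows "Re (inner_m W m (special_laplacian W (induced_edges W E) b m f) f)
    \<le> Re (inner_m V m (special_laplacian V E b m f) f)"
proof -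
  let ?a = "\<lambda>x y. complex_of_real (sym_weight b x y)"
  have EV: "induced_edges V E = E" using edges_subset by (auto simp: induced_edges_def)
  have form: "inner_m X m (special_laplacian X (induced_edges X E) b m f) f =
      (\<Sum>x\<in>X. \<Sum>y\<in>X. ?a x y * (f x - f y) * cnj (f x))" if "X \<subseteq> V" for X
  proof -
    have "m x \<noteq> 0" if "x \<in> X" for x using m_pos \<open>X \<subseteq> V\<close> that by (metis less_irrefl subsetD)
    then show ?thesis unfolding inner_m_def
      by (intro sum.cong refl)
        (simp add: special_laplacian_eq[OF that] sum_distrib_left sum_distrib_right mult.assoc)
  qed
  have z: "f x = 0" if "x \<in> V - W" for x using assms(2) that by (simp add: funs_on_def)
  have "inner_m V m (special_laplacian V E b m f) f =
      (\<Sum>x\<in>V. \<Sum>y\<in>V. ?a x y * (f x - f y) * cnj (f x))"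
    using form[OF order_refl] by (simp add: EV)
  also have "\<dots> = (\<Sum>x\<in>W. \<Sum>y\<in>V. ?a x y * (f x - f y) * cnj (f x))"
    using finite_vertices assms(1) z by (intro sum.mono_neutral_right) auto
  also have "\<dots> = (\<Sum>x\<in>W. \<Sum>y\<in>W. ?a x y * (f x - f y) * cnj (f x)) +
      (\<Sum>x\<in>W. \<Sum>y\<in>V - W. ?a x y * (f x - f y) * cnj (f x))"
    unfolding sum.distrib[symmetric] using finite_vertices assms(1)
    by (intro sum.cong refl) (simp add: sum.subset_diff[of W V] add.commute)
  finally have eq: "inner_m V m (special_laplacian V E b m f) f =
      inner_m W m (special_laplacian W (induced_edges W E) b m f) f +
      (\<Sum>x\<in>W. \<Sum>y\<in>V - W. ?a x y * (f x - f y) * cnj (f x))"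
    by (simp add: form[OF assms(1)])
  have "(\<Sum>x\<in>W. \<Sum>y\<in>V - W. ?a x y * (f x - f y) * cnj (f x)) =
      of_real (\<Sum>x\<in>W. \<Sum>y\<in>V - W. sym_weight b x y * (cmod (f x))\<^sup>2)"
    unfolding of_real_sum
    by (intro sum.cong refl) (simp add: z complex_norm_square mult.assoc del: of_real_power)
  moreover have "0 \<le> (\<Sum>x\<in>W. \<Sum>y\<in>V - W. sym_weight b x y * (cmod (f x))\<^sup>2)"
    using assms(1) b_nonneg by (intro sum_nonneg) (auto simp: sym_weight_def)
  ultimately show ?thesis using eq by simp
qed

text \<open>This identifies the two norms that \<open>\<tau>\<close> multiplies in the bounds for
  the two graphs.\<close>

lemma inner_m_funs_on:
  assumes "W \<subseteq> V" "f \<in> funs_on W"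
  shows "inner_m V m f f = inner_m W m f f"
  unfolding inner_m_def using assms finite_vertices
  by (intro sum.mono_neutral_right) (auto simp: funs_on_def)

end

section \<open>Comparison of eigenvalues by counting dimensions\<close>

theorem theorem3p1:
  fixes V_G V_H :: "'a set" and E_G E_H :: "('a \<times> 'a) set"
    and b :: "'a \<Rightarrow> 'a \<Rightarrow> real" and m :: "'a \<Rightarrow> real"
    and n r k :: nat
  assumes "weighted_digraph V_G E_G b m"
    and "connected_digraph V_G E_G"
    and "\<And>x. x \<in> V_G \<Longrightarrow> out_nbrs E_G x \<noteq> {} \<and> in_nbrs E_G x \<noteq> {}"
    and "assumption_beta V_G E_G b"
    and "card V_G = n"
    and "V_H \<subseteq> V_G" and "E_H = induced_edges V_H E_G"
    and "connected_digraph V_H E_H"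
    and "card V_H = r"
    and "1 \<le> k" and "k \<le> r"
  shows "nth_eigenvalue V_H (special_laplacian V_H E_H b m) k
    \<le> nth_eigenvalue V_G (special_laplacian V_G E_G b m) (n - r + k)"
proof (rule ccontr)
  interpret weighted_digraph V_G E_G b m by (rule assms(1))
  let ?SG = "special_laplacian V_G E_G b m" and ?SH = "special_laplacian V_H E_H b m"
  \<comment> \<open>The operator facts concern induced edge sets; the whole graph is the subgraph
    induced on all its vertices.\<close>
  have "induced_edges V_G E_G = E_G" using edges_subset by (auto simp: induced_edges_def)
  then interpret G: symmetric_operator V_G m ?SG
    using symmetric_operator_special_laplacian[OF order_refl] by simp
  interpret H: symmetric_operator V_H m ?SH
    using symmetric_operator_special_laplacian[OF assms(6)] assms(7) by simp
  obtain BG eG where BG: "G.eigenbasis BG eG" using G.eigenbasis_exists by blast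
  obtain BH eH where BH: "H.eigenbasis BH eH" using H.eigenbasis_exists by blast
  define \<tau> where "\<tau> = nth_eigenvalue V_G ?SG (n - r + k)"
  assume "\<not> nth_eigenvalue V_H ?SH k \<le> nth_eigenvalue V_G ?SG (n - r + k)"
  then have gt: "\<tau> < eigenvalue_list V_H ?SH ! (k - 1)"
    by (simp add: \<tau>_def nth_eigenvalue_def)
  \<comment> \<open>Subtraction on naturals truncates; this bound makes \<open>n - r\<close> the
    true difference.\<close>
  have rn: "r \<le> n" using assms(5,6,9) finite_vertices card_mono by metis
  define P where "P = {v\<in>BG. eG v \<le> \<tau>}"
  define N where "N = {v\<in>BH. \<tau> < eH v}"
  have "n - r + k - 1 < length (eigenvalue_list V_G ?SG)"
    using G.length_eigenvalue_list[OF BG] assms rn by simp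
  \<comment> \<open>The list is indexed from 0, so eigenvalue number \<open>n - r + k\<close> has
    index \<open>n - r + k - 1\<close>, and at least \<open>n - r + k\<close> entries are at most
    \<open>\<tau>\<close>.\<close>
  from sorted_count_le_nth[OF G.sorted_eigenvalue_list[OF BG] this]
  have cardP: "n - r + k \<le> card P"
    using G.length_filter_eigenvalue_list[OF BG, of "\<lambda>y. y \<le> \<tau>"] assms(10)
    by (simp add: P_def \<tau>_def nth_eigenvalue_def)
  have "k - 1 < length (eigenvalue_list V_H ?SH)"
    using H.length_eigenvalue_list[OF BH] assms by simp
  \<comment> \<open>The indices from \<open>k - 1\<close> to \<open>r - 1\<close> number
    \<open>r - k + 1\<close>.\<close>
  from sorted_count_gt[OF H.sorted_eigenvalue_list[OF BH] this gt]
  have cardN: "r - k + 1 \<le> card N"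
    using H.length_filter_eigenvalue_list[OF BH, of "\<lambda>y. \<tau> < y"] assms(9-11)
      H.length_eigenvalue_list[OF BH] by (simp add: N_def)
  have PB: "P \<subseteq> BG" and NB: "N \<subseteq> BH" by (auto simp: P_def N_def)
  note orthP = orthogonal_in_subset[OF G.basis_orthogonal[OF BG] PB]
  note orthN = orthogonal_in_subset[OF H.basis_orthogonal[OF BH] NB]
  have fin: "finite P" "finite N" using orthP orthN by (auto simp: orthogonal_in_def)
  \<comment> \<open>A nonzero common vector vanishes outside \<open>V_H\<close> and has its form on
    \<open>H\<close> above \<open>\<tau>\<close> times its squared norm, yet its form on
    \<open>G\<close> is at most that. This contradicts the monotonicity of the form.\<close>
  have no_common: "f = 0"
    if fP: "f = (\<Sum>v\<in>P. (\<lambda>x. u v * v x))" and fN: "f = (\<Sum>v\<in>N. (\<lambda>x. w v * v x))" for f u w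
  proof (rule ccontr)
    assume "f \<noteq> 0"
    have fH: "f \<in> funs_on V_H" unfolding fN by (rule H.combination_in_funs_on[OF BH NB])
    have "\<tau> * Re (inner_m V_H m f f) < Re (inner_m V_H m (?SH f) f)"
      using H.inner_m_combination_bounds(2)[OF BH NB fN _ \<open>f \<noteq> 0\<close>] by (simp add: N_def)
    also have "\<dots> \<le> Re (inner_m V_G m (?SG f) f)"
      using special_laplacian_form_mono[OF assms(6) fH] assms(7) by simp
    also have "\<dots> \<le> \<tau> * Re (inner_m V_G m f f)"
      using G.inner_m_combination_bounds(1)[OF BG PB fP] by (simp add: P_def)
    finally show False by (simp add: inner_m_funs_on[OF assms(6) fH])
  qed
  \<comment> \<open>A shared basis vector is a combination of either family with coefficient 1 at
    itself, so \<open>no_common\<close> would make it zero.\<close>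
  have disj: "P \<inter> N = {}"
  proof (rule ccontr)
    assume "P \<inter> N \<noteq> {}"
    then obtain v where v: "v \<in> P" "v \<in> N" by blast
    let ?u = "\<lambda>w. if w = v then 1 else 0 :: complex"
    have "v = (\<Sum>w\<in>C. (\<lambda>x. ?u w * w x))" if "finite C" "v \<in> C" for C
      by (rule ext) (use that in \<open>simp add: sum_fun_apply if_distrib[of "\<lambda>z. z * _"] cong: if_cong\<close>)
    then have "v = 0" using v fin by (intro no_common)
    then show False using v orthP by (auto simp: orthogonal_in_def)
  qed
  have indep: "cfun.independent P" "cfun.independent N"
    using G.orthogonal_in_independent[OF orthP] H.orthogonal_in_independent[OF orthN] .
  \<comment> \<open>In a vanishing combination the part over \<open>P\<close> is minus the part over
    \<open>N\<close>. By \<open>no_common\<close> both parts vanish, and the independence of each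
    family finishes.\<close>
  have "cfun.independent (P \<union> N)"
  proof -
    have "u v = 0" if s: "(\<Sum>v\<in>P \<union> N. (\<lambda>x. u v * v x)) = 0" and v: "v \<in> P \<union> N" for u v
    proof -
      let ?p = "\<Sum>v\<in>P. (\<lambda>x. u v * v x)" and ?n = "\<Sum>v\<in>N. (\<lambda>x. u v * v x)"
      have 0: "?p + ?n = 0" using s sum.union_disjoint[OF fin disj] by metis
      then have "?p = - ?n" by (simp add: eq_neg_iff_add_eq_0)
      \<comment> \<open>The sign moves into the coefficients to give a combination over
        \<open>N\<close>.\<close>
      also have "\<dots> = (\<Sum>v\<in>N. (\<lambda>x. (- u v) * v x))"
        by (simp add: fun_eq_iff sum_fun_apply sum_negf)
      finally have "?p = 0" by (intro no_common[OF refl])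
      then have "?n = 0" using 0 by simp
      then show ?thesis using \<open>?p = 0\<close> v indep fin by (auto simp: cfun.dependent_finite)
    qed
    then show ?thesis using fin by (auto simp: cfun.dependent_finite)
  qed
  moreover have "P \<union> N \<subseteq> funs_on V_G"
    using orthP orthN assms(6) by (fastforce simp: orthogonal_in_def funs_on_def)
  ultimately have "card (P \<union> N) \<le> n" using G.independent_card_le assms(5) by blast
  moreover have "card (P \<union> N) = card P + card N" by (rule card_Un_disjoint[OF fin disj])
  \<comment> \<open>The two counts add up to
    \<open>(n - r + k) + (r - k + 1) = n + 1\<close>.\<close>
  ultimately show False using cardP cardN rn assms(11) by simp
qed

end
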